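(* Let $k$ be a field, $S=k[t]$, and let $R$ be a $k$-subalgebra of $S$ with $t^{c_0}S\subseteq R$ for a fixed integer $c_0>0$. Let $I\ne(0)$ be an ideal of $R$, and write $IS=\varphi S$ with $\varphi=t^qf$, where $q\ge 0$ is an integer and $f\in S$ satisfies $f(0)=1$. Let $\ell,c\ge c_0$ be integers with $\ell\ge 2$, and let $g\in S$ be the polynomial of degree at most $\ell-1$ associated with $f$ and $\ell$ (see context). Let $\overline I$ denote the integral closure of the ideal $I$ in $R$. Then: (1) If $c\ge q$, then $\overline I=t^cf\,R+fg\cdot(t^qS\cap R)$; hence $\mu_R(\overline I)\le 1+\mu_R(t^qS\cap R)$. (2) If $q\ge c_0$, then $\overline I=\varphi S$ and $\mu_R(\overline I)=\mu_R(S)$.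
   Context: $\mu_R(-)$ is the minimal number of generators of an $R$-module. Definition of $g$: write $f=\sum_{i\ge 0}a_it^i$ with $a_i\in k$ (so $a_0=1$), and set $a_m=0$ for $m<0$. Let $A$ be the $(\ell-1)\times\ell$ matrix over $k$ with entries $A_{ij}=a_{i-j}$ for $1\le i\le \ell-1$ and $0\le j\le \ell-1$; that is, its $i$-th row is $(a_i,a_{i-1},\dots,a_1,1,0,\dots,0)$. It has rank $\ell-1$, and there is a unique vector $\mathbf v=(v_0,v_1,\dots,v_{\ell-1})^{T}\in k^{\ell}$ with $A\mathbf v=0$ and $v_0=1$. Put $g=\sum_{i=0}^{\ell-1}v_it^i\in S$. The element $fg$ lies in $R$. *)

theory Defs
  imports
    "HOL-Library.Extended_Nat"
    "HOL-Computational_Algebra.Polynomial_FPS"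
    "HOL-Algebra.Ideal_Product"
    "HOL-Algebra.Subrings"
    "Jordan_Normal_Form.Matrix_Kernel"
begin

hide_const (open) UnivPoly.up_ring.monom UnivPoly.up_ring.coeff

text \<open>The ring \<open>k[t]\<close> is \<open>class_ring\<close> at type \<open>'k poly\<close>, with \<open>t\<close> the polynomial \<open>monom 1 1\<close>.\<close>

abbreviation poly_ring :: "'k::field poly ring" where
  "poly_ring \<equiv> class_ring"

abbreviation poly_subring :: "'k::field poly set \<Rightarrow> 'k poly ring" where
  "poly_subring R \<equiv> poly_ring\<lparr>carrier := R\<rparr>"

abbreviation poly_t :: "'k::field poly" where
  "poly_t \<equiv> monom 1 1"

text \<open>A set of polynomials viewed as a module, with multiplication of polynomials as the scalar
  action. The fields \<open>mult\<close> and \<open>one\<close> are part of the record type of modules and play no role.\<close>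

definition poly_module :: "'k::field poly set \<Rightarrow> ('k poly, 'k poly) module" where
  "poly_module M = \<lparr>carrier = M, mult = (*), one = 1, zero = 0, add = (+), smult = (*)\<rparr>"

text \<open>The value is \<open>\<infinity>\<close> exactly when the module is not finitely generated.\<close>

definition min_gens :: "('a, 'r) ring_scheme \<Rightarrow> ('a, 'b, 'm) module_scheme \<Rightarrow> enat" where
  "min_gens R M =
    Inf {enat (card G) | G. finite G \<and> G \<subseteq> carrier M \<and> module.gen_set R M G}"

abbreviation mu :: "'k::field poly set \<Rightarrow> 'k poly set \<Rightarrow> enat" where
  "mu R M \<equiv> min_gens (poly_subring R) (poly_module M)"

text \<open>The elements of \<open>R\<close> satisfying an equation \<open>x\<^sup>n + a\<^sub>1 x\<^bsup>n-1\<^esup> + \<dots> + a\<^sub>n = 0\<close> with \<open>n \<ge> 1\<close> and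
  each \<open>a\<^sub>i\<close> in the ideal power \<open>I\<^sup>i\<close>, the latter taken in the monoid of ideals.\<close>

definition integral_closure :: "('a, 'r) ring_scheme \<Rightarrow> 'a set \<Rightarrow> 'a set" where
  "integral_closure R I = {x \<in> carrier R. \<exists>(n::nat) a. n \<ge> 1 \<and>
      (\<forall>i\<in>{1..n}. a i \<in> I [^]\<^bsub>ideals_set R\<^esub> i) \<and>
      x [^]\<^bsub>R\<^esub> n \<oplus>\<^bsub>R\<^esub> (\<Oplus>\<^bsub>R\<^esub>i\<in>{1..n}. a i \<otimes>\<^bsub>R\<^esub> x [^]\<^bsub>R\<^esub> (n - i)) = \<zero>\<^bsub>R\<^esub>}"

text \<open>The matrix with entries \<open>a\<^bsub>i-j\<^esub>\<close> for \<open>1 \<le> i \<le> l - 1\<close> and \<open>0 \<le> j \<le> l - 1\<close>, where \<open>a\<^sub>m\<close> is the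
  \<open>m\<close>-th coefficient of \<open>f\<close> and \<open>a\<^sub>m = 0\<close> for \<open>m < 0\<close>. Matrix rows are numbered from \<open>0\<close>, so row
  \<open>r\<close> holds the entries with \<open>i = r + 1\<close>.\<close>

definition coeff_mat :: "'k::field poly \<Rightarrow> nat \<Rightarrow> 'k mat" where
  "coeff_mat f l = mat (l - 1) l (\<lambda>(r, j). if j \<le> r + 1 then coeff f (r + 1 - j) else 0)"

lemma mat_kernel_coeff_mat_iff:
  assumes "l \<ge> 2"
  shows "v \<in> mat_kernel (coeff_mat f l) \<longleftrightarrow> v \<in> carrier_vec l \<and>
     (\<forall>i\<in>{1..<l}. (\<Sum>j\<le>i. coeff f (i - j) * v $ j) = 0)"
proof -
  have *: "(coeff_mat f l *\<^sub>v v) $ r = (\<Sum>j\<le>Suc r. coeff f (Suc r - j) * v $ j)"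
    if "v \<in> carrier_vec l" "r < l - 1" for r
  proof -
    have "(coeff_mat f l *\<^sub>v v) $ r = (\<Sum>j<l. (if j \<le> Suc r then coeff f (Suc r - j) else 0) * v $ j)"
      using that by (auto simp: coeff_mat_def scalar_prod_def lessThan_atLeast0 intro!: sum.cong)
    also have "\<dots> = (\<Sum>j\<le>Suc r. coeff f (Suc r - j) * v $ j)"
      using that by (intro sum.mono_neutral_cong_right) auto
    finally show ?thesis .
  qed
  have d: "dim_row (coeff_mat f l) = l - 1" "dim_col (coeff_mat f l) = l"
    by (auto simp: coeff_mat_def)
  show ?thesis
  proof (cases "v \<in> carrier_vec l")
    case True
    have "v \<in> mat_kernel (coeff_mat f l) \<longleftrightarrow> (\<forall>r<l-1. (\<Sum>j\<le>Suc r. coeff f (Suc r - j) * v $ j) = 0)"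
      using True d by (auto simp: mat_kernel_def vec_eq_iff * simp del: sum.atMost_Suc index_mult_mat_vec)
    also have "\<dots> \<longleftrightarrow> (\<forall>i\<in>{1..<l}. (\<Sum>j\<le>i. coeff f (i - j) * v $ j) = 0)"
    proof safe
      fix i assume "\<forall>r<l - 1. (\<Sum>j\<le>Suc r. coeff f (Suc r - j) * v $ j) = 0" "i \<in> {1..<l}"
      then show "(\<Sum>j\<le>i. coeff f (i - j) * v $ j) = 0"
        by (cases i) auto
    qed (auto simp del: sum.atMost_Suc)
    finally show ?thesis using True by simp
  qed (auto simp: mat_kernel_def d)
qed

lemma assoc_vec_ex1:
  assumes "poly f 0 = 1" "l \<ge> 2"
  shows "\<exists>!v. v \<in> mat_kernel (coeff_mat f l) \<and> v $ 0 = 1"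
proof (rule ex_ex1I)
  let ?w = "inverse (fps_of_poly f)"
  have f0: "coeff f 0 = 1" using assms by (simp add: poly_0_coeff_0)
  have "?w * fps_of_poly f = 1" using f0 by (intro inverse_mult_eq_1) simp
  have "(\<Sum>j\<le>i. coeff f (i - j) * fps_nth ?w j) = 0" if "i \<in> {1..<l}" for i
  proof -
    have "(\<Sum>j\<le>i. coeff f (i - j) * fps_nth ?w j) = fps_nth (?w * fps_of_poly f) i"
      by (simp add: fps_mult_nth mult.commute[of "coeff f _"] atMost_atLeast0)
    thus ?thesis using that \<open>?w * fps_of_poly f = 1\<close> by simp
  qed
  moreover have "fps_nth ?w 0 = 1" using f0 by simp
  ultimately show "\<exists>v. v \<in> mat_kernel (coeff_mat f l) \<and> v $ 0 = 1"
    using assms by (intro exI[of _ "vec l (fps_nth ?w)"]) (auto simp: mat_kernel_coeff_mat_iff)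
next
  fix v w
  have f0: "coeff f 0 = 1" using assms by (simp add: poly_0_coeff_0)
  assume "v \<in> mat_kernel (coeff_mat f l) \<and> v $ 0 = 1" "w \<in> mat_kernel (coeff_mat f l) \<and> w $ 0 = 1"
  note vw = this[unfolded mat_kernel_coeff_mat_iff[OF assms(2)]]
  have "i < l \<Longrightarrow> v $ i = w $ i" for i
  proof (induction i rule: less_induct)
    case (less i)
    show ?case
    proof (cases "i = 0")
      case False
      hence "(\<Sum>j\<le>i. coeff f (i - j) * v $ j) = (\<Sum>j\<le>i. coeff f (i - j) * w $ j)"
        using vw less.prems by auto
      moreover have "(\<Sum>j<i. coeff f (i - j) * v $ j) = (\<Sum>j<i. coeff f (i - j) * w $ j)"
        using less by (intro sum.cong) auto
      ultimately show ?thesis using f0 by (simp flip: lessThan_Suc_atMost)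
    qed (use vw in auto)
  qed
  thus "v = w" using vw by auto
qed

text \<open>Well defined by \<open>assoc_vec_ex1\<close> whenever \<open>f(0) = 1\<close> and \<open>l \<ge> 2\<close>.\<close>

definition assoc_vec :: "'k::field poly \<Rightarrow> nat \<Rightarrow> 'k vec" where
  "assoc_vec f l = (THE v. v \<in> mat_kernel (coeff_mat f l) \<and> v $ 0 = 1)"

definition assoc_poly :: "'k::field poly \<Rightarrow> nat \<Rightarrow> 'k poly" where
  "assoc_poly f l = (\<Sum>i<l. monom (assoc_vec f l $ i) i)"

end

(* The integral closure of I in R is IS \<inter> R = \<phi>S \<inter> R. An integral equation of x over I forces \<phi> to
   divide x because k[t] is integrally closed. Conversely, t^c0 \<phi>^n S \<subseteq> I^n for all n, since
   (t^c0 \<phi>^n S) I = (t^c0 \<phi>^n S) \<phi>S. As IS = \<phi>S, some y \<in> I has order exactly q at t = 0; so for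
   x \<in> \<phi>S \<inter> R there is b \<in> ky with x + b \<in> t\<phi>S, and (x (x + b))^c0 \<in> t^c0 \<phi>^(2 c0) S \<subseteq> I^(2 c0)
   is an equation of integral dependence of degree 2 c0.

   For (1), fg = 1 modulo t^l, so fg \<in> R, and g has an inverse u modulo t^(2c); an element
   x = t^q f w of R is recovered from s = t^q w u. For (2), \<phi>S \<subseteq> R, and multiplication by \<phi>
   is an isomorphism from S to \<phi>S. *)

theory Submission
  imports Defs
begin

section \<open>Divisibility in k[t] and integral equations\<close>

lemma PIdl_poly_ring: "PIdl\<^bsub>poly_ring\<^esub> p = {x. p dvd x}"
  by (auto simp: cgenideal_def dvd_def mult.commute)

text \<open>A nonzero element of least degree in the ideal generated by \<open>x\<close> and
  \<open>y\<close> divides both: a nonzero remainder would lie in that ideal and have smaller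
  degree.\<close>

lemma poly_bezout:
  fixes x y :: "'k::field poly"
  obtains d a b where "d = a * x + b * y" "d dvd x" "d dvd y"
proof (cases "x = 0 \<and> y = 0")
  case False
  define A where "A = {z. z \<noteq> 0 \<and> (\<exists>a b. z = a * x + b * y)}"
  have xy: "z \<in> A" if "z \<noteq> 0" "z = x \<or> z = y" for z
    using that unfolding A_def
    by (auto intro: exI[of _ 0] exI[of _ 1])
  with False obtain z where "z \<in> A" by blast
  then obtain d where d: "d \<in> A" "\<forall>z. z \<in> A \<longrightarrow> degree d \<le> degree z"
    using ex_has_least_nat[of "\<lambda>z. z \<in> A" z degree] by blast
  then obtain a b where ab: "d = a * x + b * y" and "d \<noteq> 0" by (auto simp: A_def)
  have "d dvd z" if z: "z = x \<or> z = y" for z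
  proof (rule ccontr)
    assume nd: "\<not> d dvd z"
    then have "z mod d \<noteq> 0" by (simp add: dvd_eq_mod_eq_0)
    moreover have "\<exists>a b. z mod d = a * x + b * y"
    proof -
      have e: "z mod d = z - z div d * d" by (simp add: minus_div_mult_eq_mod)
      from z show ?thesis
      proof
        assume "z = x"
        then have "z mod d = (1 - z div d * a) * x + (- (z div d * b)) * y"
          using e ab by (simp add: algebra_simps)
        then show ?thesis by blast
      next
        assume "z = y"
        then have "z mod d = (- (z div d * a)) * x + (1 - z div d * b) * y"
          using e ab by (simp add: algebra_simps)
        then show ?thesis by blast
      qed
    qed
    ultimately have "z mod d \<in> A" by (simp add: A_def)
    with d have "degree d \<le> degree (z mod d)" by blast
    with degree_mod_less[OF \<open>d \<noteq> 0\<close>, of z] \<open>z mod d \<noteq> 0\<close> show False by simp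
  qed
  with ab that show thesis by blast
qed (use that[of 0 0 0] in auto)

text \<open>Multiplying the Bezout identity by \<open>x ^ n\<close> shows that \<open>p\<close>
  divides \<open>x ^ n\<close> as soon as it divides \<open>x ^ Suc n\<close>; the descent ends at
  \<open>x ^ 0 = 1\<close>.\<close>

lemma dvd_of_dvd_power_coprime:
  fixes a b p x :: "'a::comm_ring_1"
  assumes "a * x + b * p = 1" "p dvd x ^ n"
  shows "p dvd 1"
  using assms(2)
proof (induction n)
  case (Suc n)
  have "x ^ n = (a * x + b * p) * x ^ n" using assms(1) by simp
  also have "\<dots> = a * x ^ Suc n + p * (b * x ^ n)" by (simp add: algebra_simps)
  finally have "p dvd x ^ n" using Suc.prems by (metis dvd_add dvd_mult dvd_triv_left)
  then show ?case by (rule Suc.IH)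
qed simp

text \<open>This is the integral closedness of k[t] applied to \<open>x / p\<close>, without passing
  to the fraction field. After a common divisor \<open>d\<close> is removed, the cofactors
  \<open>x'\<close> and \<open>p'\<close> are coprime; the equation makes \<open>p'\<close> divide
  \<open>x' ^ n\<close>, so \<open>p'\<close> is a unit.\<close>

lemma dvd_of_integral_equation:
  fixes x p :: "'k::field poly"
  assumes "p \<noteq> 0" and "n \<ge> 1"
    and a: "\<And>i. i \<in> {1..n} \<Longrightarrow> p ^ i dvd a i"
    and eq: "x ^ n + (\<Sum>i\<in>{1..n}. a i * x ^ (n - i)) = 0"
  shows "p dvd x"
proof -
  obtain d u v where d: "d = u * x + v * p" "d dvd x" "d dvd p" by (rule poly_bezout)
  from d(2) obtain x' where x': "x = d * x'" by (rule dvdE)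
  from d(3) obtain p' where p': "p = d * p'" by (rule dvdE)
  have "d \<noteq> 0" using p' \<open>p \<noteq> 0\<close> by auto
  have "d * (u * x' + v * p') = d * 1" using d(1) x' p' by (simp add: algebra_simps)
  with \<open>d \<noteq> 0\<close> have one: "u * x' + v * p' = 1" by (metis mult_cancel_left)
  have "d ^ n * p' dvd a i * x ^ (n - i)" if i: "i \<in> {1..n}" for i
  proof -
    \<comment> \<open>Since \<open>i \<ge> 1\<close>, the power
      \<open>p ^ i = d ^ i * p' ^ i\<close> contains at least one factor \<open>p'\<close>.\<close>
    have "d ^ i * p' dvd p ^ i"
      using i by (simp add: p' power_mult_distrib)
    then have "d ^ i * p' dvd a i" using a[OF i] by (rule dvd_trans)
    moreover have "d ^ (n - i) dvd x ^ (n - i)" by (simp add: x' power_mult_distrib)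
    ultimately have "d ^ i * p' * d ^ (n - i) dvd a i * x ^ (n - i)" by (rule mult_dvd_mono)
    moreover have "d ^ i * p' * d ^ (n - i) = d ^ n * p'"
      using i by (simp add: mult_ac flip: power_add)
    ultimately show ?thesis by simp
  qed
  then have "d ^ n * p' dvd (\<Sum>i\<in>{1..n}. a i * x ^ (n - i))" by (rule dvd_sum)
  moreover have "x ^ n = - (\<Sum>i\<in>{1..n}. a i * x ^ (n - i))"
    using eq by (simp add: eq_neg_iff_add_eq_0)
  ultimately have "d ^ n * p' dvd d ^ n * x' ^ n" by (simp add: x' power_mult_distrib)
  then have "p' dvd x' ^ n" using \<open>d \<noteq> 0\<close> by simp
  with one have "p' dvd 1" by (rule dvd_of_dvd_power_coprime)
  then have "d * p' dvd d * x'" by (intro mult_dvd_mono) (auto intro: dvd_trans)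
  then show ?thesis by (simp add: x' p')
qed

text \<open>Otherwise the simplifier unfolds \<^term>\<open>poly_subring R\<close> to a record with explicit fields, and the
  facts about this ring no longer match.\<close>

declare partial_object.update_convs [simp del]

section \<open>Subrings of k[t], their modules and numbers of generators\<close>

locale polynomial_subring =
  fixes R :: "'k::field poly set"
  assumes subring: "subring R poly_ring"
begin

lemma R_zero: "0 \<in> R" and R_one: "1 \<in> R"
  and R_add: "x \<in> R \<Longrightarrow> y \<in> R \<Longrightarrow> x + y \<in> R"
  and R_mult: "x \<in> R \<Longrightarrow> y \<in> R \<Longrightarrow> x * y \<in> R"
  and R_uminus: "x \<in> R \<Longrightarrow> - x \<in> R"
  \<comment> \<open>\<open>matrix_vs_simps(14)\<close> identifies the additive inverse of
    \<open>class_ring\<close> with unary minus.\<close>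
  using subringE[OF subring] by (simp_all add: matrix_vs_simps(14))

lemma R_diff: "x \<in> R \<Longrightarrow> y \<in> R \<Longrightarrow> x - y \<in> R"
  using R_add[of x "- y"] R_uminus by simp

lemma R_power: "x \<in> R \<Longrightarrow> x ^ n \<in> R"
  by (induction n) (auto simp: R_one R_mult)

lemma cring: "cring (poly_subring R)"
  using ring.subcring_iff[OF class_ring.ring_axioms, of R] cring.subcringI'[OF class_cring.cring_axioms subring]
  by simp

sublocale R: cring "poly_subring R" by (rule cring)

lemma nat_pow_eq: "x [^]\<^bsub>poly_subring R\<^esub> (n::nat) = x ^ n"
  by (induction n) (simp_all add: mult.commute)

lemma finsum_eq: "(\<And>i. i \<in> A \<Longrightarrow> h i \<in> R) \<Longrightarrow> finsum (poly_subring R) h A = sum h A"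
proof (induction A rule: infinite_finite_induct)
  case (insert a A)
  then show ?case by (subst R.finsum_insert) auto
qed simp_all

text \<open>These are the \<open>R\<close>-submodules of S; closure under negation comes from the
  scalar \<open>- 1\<close>.\<close>

definition submod :: "'k poly set \<Rightarrow> bool" where
  "submod M \<longleftrightarrow> 0 \<in> M \<and> (\<forall>x\<in>M. \<forall>y\<in>M. x + y \<in> M) \<and> (\<forall>r\<in>R. \<forall>x\<in>M. r * x \<in> M)"

lemma submodD:
  assumes "submod M"
  shows "0 \<in> M" and "x \<in> M \<Longrightarrow> y \<in> M \<Longrightarrow> x + y \<in> M" and "r \<in> R \<Longrightarrow> x \<in> M \<Longrightarrow> r * x \<in> M"
  using assms by (auto simp: submod_def)

lemma submod_sum: "submod M \<Longrightarrow> (\<And>i. i \<in> A \<Longrightarrow> h i \<in> M) \<Longrightarrow> sum h A \<in> M"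
  by (induction A rule: infinite_finite_induct) (simp_all add: submodD)

lemma submod_UNIV: "submod UNIV"
  by (simp add: submod_def)

lemma submod_dvd_Int: "submod {x \<in> R. p dvd x}"
  by (auto simp: submod_def R_zero R_add R_mult)

text \<open>A concrete form of \<open>module.span\<close>, which it equals on finite subsets of a
  submodule by \<open>span_poly_module\<close>. For infinite \<open>G\<close> the sums take the
  default value 0.\<close>

definition lin_span :: "'k poly set \<Rightarrow> 'k poly set" where
  "lin_span G = {(\<Sum>x\<in>G. a x * x) | a. a \<in> G \<rightarrow> R}"

lemma lin_spanI: "a \<in> G \<rightarrow> R \<Longrightarrow> (\<Sum>x\<in>G. a x * x) \<in> lin_span G"
  unfolding lin_span_def by blast

lemma lin_spanE:
  assumes "u \<in> lin_span G"
  obtains a where "a \<in> G \<rightarrow> R" "u = (\<Sum>x\<in>G. a x * x)"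
  using assms unfolding lin_span_def by blast

lemma submod_lin_span: "submod (lin_span G)"
  unfolding submod_def
proof (intro conjI ballI)
  show "0 \<in> lin_span G"
    using lin_spanI[of "\<lambda>_. 0" G] by (simp add: R_zero)
next
  fix u v assume "u \<in> lin_span G" "v \<in> lin_span G"
  obtain a where a: "a \<in> G \<rightarrow> R" "u = (\<Sum>x\<in>G. a x * x)"
    using \<open>u \<in> lin_span G\<close> by (rule lin_spanE)
  obtain b where b: "b \<in> G \<rightarrow> R" "v = (\<Sum>x\<in>G. b x * x)"
    using \<open>v \<in> lin_span G\<close> by (rule lin_spanE)
  have "(\<lambda>x. a x + b x) \<in> G \<rightarrow> R" using a(1) b(1) by (simp add: Pi_iff R_add)
  from lin_spanI[OF this] show "u + v \<in> lin_span G"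
    by (simp add: a(2) b(2) sum.distrib distrib_right)
next
  fix r u assume "r \<in> R" "u \<in> lin_span G"
  obtain a where a: "a \<in> G \<rightarrow> R" "u = (\<Sum>x\<in>G. a x * x)"
    using \<open>u \<in> lin_span G\<close> by (rule lin_spanE)
  have "(\<lambda>x. r * a x) \<in> G \<rightarrow> R" using a(1) \<open>r \<in> R\<close> by (simp add: Pi_iff R_mult)
  from lin_spanI[OF this] show "r * u \<in> lin_span G"
    by (simp add: a(2) sum_distrib_left mult.assoc)
qed

lemma lin_span_superset:
  assumes "finite G"
  shows "G \<subseteq> lin_span G"
proof
  fix g assume "g \<in> G"
  have "(\<Sum>x\<in>G. (if x = g then 1 else 0) * x) = (\<Sum>x\<in>G. if x = g then x else 0)"
    by (rule sum.cong) simp_all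
  also have "\<dots> = g" using assms \<open>g \<in> G\<close> by simp
  finally show "g \<in> lin_span G"
    using lin_spanI[of "\<lambda>x. if x = g then 1 else 0" G] by (simp add: R_zero R_one)
qed

lemma lin_span_minimal:
  assumes "submod M" and "G \<subseteq> M"
  shows "lin_span G \<subseteq> M"
  using assms(2) by (auto elim!: lin_spanE intro!: submod_sum[OF assms(1)] submodD(3)[OF assms(1)])

lemma module_poly_module:
  assumes M: "submod M"
  shows "module (poly_subring R) (poly_module M)"
proof (rule moduleI[OF cring])
  show "abelian_group (poly_module M)"
  proof (rule abelian_groupI)
    fix x assume "x \<in> carrier (poly_module M)"
    then have "- x \<in> M" using submodD(3)[OF M, of "- 1" x]
      by (simp add: poly_module_def R_uminus R_one)
    then show "\<exists>y\<in>carrier (poly_module M). y \<oplus>\<^bsub>poly_module M\<^esub> x = \<zero>\<^bsub>poly_module M\<^esub>"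
      by (intro bexI[of _ "- x"]) (simp_all add: poly_module_def)
  qed (simp_all add: poly_module_def submodD[OF M] add_ac)
qed (simp_all add: poly_module_def submodD[OF M] distrib_left distrib_right mult.assoc)

lemma finsum_poly_module:
  assumes "submod M" and "\<And>i. i \<in> A \<Longrightarrow> h i \<in> M"
  shows "finsum (poly_module M) h A = sum h A"
proof -
  interpret M: abelian_group "poly_module M" using module_poly_module[OF assms(1)] by (rule module.axioms)
  have sel: "carrier (poly_module M) = M" "add (poly_module M) = (+)" "zero (poly_module M) = 0"
    by (simp_all add: poly_module_def)
  show ?thesis
    using assms(2)
  proof (induction A rule: infinite_finite_induct)
    case (insert a A)
    then show ?case by (subst M.finsum_insert) (simp_all add: sel Pi_iff)
  qed (simp_all add: sel)
qed

text \<open>For finite \<open>G\<close>, \<open>finite_span\<close> lets every linear combination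
  run over all of \<open>G\<close>, and sums in \<open>poly_module M\<close> are ordinary sums of
  polynomials.\<close>

lemma span_poly_module:
  assumes M: "submod M" and "finite G" and "G \<subseteq> M"
  shows "module.span (poly_subring R) (poly_module M) G = lin_span G"
proof -
  interpret M: module "poly_subring R" "poly_module M" by (rule module_poly_module[OF M])
  have "M.lincomb a G = (\<Sum>x\<in>G. a x * x)" if "a \<in> G \<rightarrow> R" for a
  proof -
    have "smult (poly_module M) = (*)" by (simp add: poly_module_def)
    then have "M.lincomb a G = finsum (poly_module M) (\<lambda>x. a x * x) G"
      by (simp add: M.lincomb_def)
    also have "\<dots> = (\<Sum>x\<in>G. a x * x)"
      using that assms(3) by (intro finsum_poly_module[OF M] submodD(3)[OF M]) auto
    finally show ?thesis .
  qed
  moreover have "M.span G = {M.lincomb a G | a. a \<in> G \<rightarrow> R}"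
    using M.finite_span[of G] assms(2,3) by (simp add: poly_module_def)
  \<comment> \<open>\<open>rev_conj_cong\<close> makes the condition on \<open>a\<close> available
    for rewriting the equation that stands before it in the comprehension.\<close>
  ultimately show ?thesis unfolding lin_span_def by (simp cong: rev_conj_cong)
qed

lemma mu_eq:
  assumes "submod M"
  shows "mu R M = Inf {enat (card G) | G. finite G \<and> G \<subseteq> M \<and> lin_span G = M}"
proof -
  have carrier: "carrier (poly_module M) = M" by (simp add: poly_module_def)
  have "(finite G \<and> G \<subseteq> M \<and> module.span (poly_subring R) (poly_module M) G = M) \<longleftrightarrow>
      (finite G \<and> G \<subseteq> M \<and> lin_span G = M)" for G
    using span_poly_module[OF assms, of G] by blast
  then show ?thesis unfolding min_gens_def carrier by simp
qed

lemma mu_le: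
  assumes "submod M" and "finite G" and "G \<subseteq> M" and "M \<subseteq> lin_span G"
  shows "mu R M \<le> enat (card G)"
proof -
  have "lin_span G = M" using assms(4) lin_span_minimal[OF assms(1,3)] by (rule equalityI[rotated])
  with assms(2,3) show ?thesis unfolding mu_eq[OF assms(1)] by (intro Inf_lower) blast
qed

text \<open>A nonempty set of extended naturals contains its infimum, so a finite value of
  \<open>mu\<close> is attained by some generating set.\<close>

lemma mu_cases:
  assumes "submod M"
  obtains "mu R M = \<infinity>"
  | G where "finite G" "G \<subseteq> M" "lin_span G = M" "mu R M = enat (card G)"
proof (cases "\<exists>G. finite G \<and> G \<subseteq> M \<and> lin_span G = M")
  case True
  then obtain H where "finite H \<and> H \<subseteq> M \<and> lin_span H = M" ..
  then have "enat (card H) \<in> {enat (card G) | G. finite G \<and> G \<subseteq> M \<and> lin_span G = M}" by blast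
  then have "mu R M \<in> {enat (card G) | G. finite G \<and> G \<subseteq> M \<and> lin_span G = M}"
    unfolding mu_eq[OF assms] by (rule wellorder_InfI)
  with that(2) show thesis by blast
next
  case False
  then have "{enat (card G) | G. finite G \<and> G \<subseteq> M \<and> lin_span G = M} = {}" by blast
  then have "mu R M = \<infinity>" unfolding mu_eq[OF assms] by (simp only: Inf_empty top_enat_def)
  with that(1) show thesis by blast
qed

text \<open>The elements of \<open>M\<close> that \<open>h\<close> sends into \<open>N\<close> form
  a submodule containing \<open>G\<close>. Linearity is asked on \<open>M\<close> only, so that
  \<open>h\<close> may be division by a fixed polynomial, which is linear on its multiples.\<close>

lemma lin_span_map:
  assumes "submod M" and "submod N" and "finite G" and "G \<subseteq> M"
    and h_zero: "h 0 = 0"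
    and h_add: "\<And>x y. x \<in> M \<Longrightarrow> y \<in> M \<Longrightarrow> h (x + y) = h x + h y"
    and h_mult: "\<And>r x. r \<in> R \<Longrightarrow> x \<in> M \<Longrightarrow> h (r * x) = r * h x"
    and "h ` G \<subseteq> N"
    and "x \<in> lin_span G"
  shows "h x \<in> N"
proof -
  have "submod {x \<in> M. h x \<in> N}"
    unfolding submod_def
    using submodD[OF assms(1)] submodD[OF assms(2)] by (simp add: h_zero h_add h_mult)
  then have "lin_span G \<subseteq> {x \<in> M. h x \<in> N}"
    by (rule lin_span_minimal) (use assms(4,8) in blast)
  with assms(9) show ?thesis by blast
qed

lemma mu_map_le:
  assumes M: "submod M" and N: "submod (h ` M)"
    and h_add: "\<And>x y. x \<in> M \<Longrightarrow> y \<in> M \<Longrightarrow> h (x + y) = h x + h y"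
    and h_mult: "\<And>r x. r \<in> R \<Longrightarrow> x \<in> M \<Longrightarrow> h (r * x) = r * h x"
  shows "mu R (h ` M) \<le> mu R M"
proof (cases rule: mu_cases[OF M])
  case (2 G)
  have h_zero: "h 0 = 0" using h_mult[of 0 0] by (simp add: R_zero submodD(1)[OF M])
  have "h x \<in> lin_span (h ` G)" if "x \<in> M" for x
    by (rule lin_span_map[OF M submod_lin_span 2(1,2) h_zero h_add h_mult])
       (use 2(1,3) that lin_span_superset[of "h ` G"] in simp_all)
  then have "mu R (h ` M) \<le> enat (card (h ` G))"
    using 2(1,2) by (intro mu_le N) auto
  also have "\<dots> \<le> enat (card G)" using 2(1) by (simp add: card_image_le)
  finally show ?thesis using 2(4) by simp
qed simp

lemma submod_mult_image:
  assumes M: "submod M"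
  shows "submod ((*) p ` M)"
  unfolding submod_def
proof (intro conjI ballI)
  show "0 \<in> (*) p ` M" using submodD(1)[OF M] by (rule rev_image_eqI) simp
next
  fix x y assume "x \<in> (*) p ` M" "y \<in> (*) p ` M"
  then obtain u v where "u \<in> M" "v \<in> M" "x = p * u" "y = p * v" by blast
  then show "x + y \<in> (*) p ` M"
    using submodD(2)[OF M, of u v] by (intro image_eqI[of _ _ "u + v"]) (simp_all add: distrib_left)
next
  fix r x assume "r \<in> R" "x \<in> (*) p ` M"
  then obtain u where "u \<in> M" "x = p * u" by blast
  then show "r * x \<in> (*) p ` M"
    using submodD(3)[OF M \<open>r \<in> R\<close>, of u] by (intro image_eqI[of _ _ "r * u"]) (simp_all add: mult_ac)
qed

text \<open>Multiplication by \<open>p\<close> and division by \<open>p\<close> are mutually inverse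
  linear maps, and \<open>mu_map_le\<close> applies to each.\<close>

lemma mu_mult_image:
  assumes "p \<noteq> 0" and M: "submod M"
  shows "mu R ((*) p ` M) = mu R M"
proof (rule antisym)
  show "mu R ((*) p ` M) \<le> mu R M"
    by (rule mu_map_le[OF M submod_mult_image[OF M]]) (simp_all only: distrib_left mult.left_commute)
  have inv: "(\<lambda>x. x div p) ` (*) p ` M = M" using assms(1) by (simp add: image_image)
  have "mu R ((\<lambda>x. x div p) ` (*) p ` M) \<le> mu R ((*) p ` M)"
  proof (rule mu_map_le[OF submod_mult_image[OF M]])
    show "submod ((\<lambda>x. x div p) ` (*) p ` M)" unfolding inv by (rule M)
  next
    fix x y assume "x \<in> (*) p ` M" "y \<in> (*) p ` M"
    then show "(x + y) div p = x div p + y div p" by (intro div_add) auto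
  next
    fix r x assume "x \<in> (*) p ` M"
    then show "(r * x) div p = r * (x div p)" by (intro div_mult_swap[symmetric]) auto
  qed
  then show "mu R M \<le> mu R ((*) p ` M)" unfolding inv .
qed

text \<open>If \<open>G\<close> is a smallest generating set of \<open>M\<close>, then
  \<open>y\<close> together with the products \<open>p * x\<close> for \<open>x \<in> G\<close>
  generates \<open>N\<close>.\<close>

lemma mu_cyclic_add_image_le:
  assumes M: "submod M" and N: "submod N"
    and N_eq: "N = {y * r + p * s | r s. r \<in> R \<and> s \<in> M}"
  shows "mu R N \<le> 1 + mu R M"
proof (cases rule: mu_cases[OF M])
  case (2 G)
  let ?G = "insert y ((*) p ` G)"
  have fin: "finite ?G" using 2(1) by simp
  have N_I: "y * r + p * s \<in> N" if "r \<in> R" "s \<in> M" for r s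
    using that unfolding N_eq by blast
  have y_span: "y \<in> lin_span ?G" and pG_span: "(*) p ` G \<subseteq> lin_span ?G"
    using lin_span_superset[OF fin] by blast+
  have "N \<subseteq> lin_span ?G"
  proof
    fix x assume "x \<in> N"
    then obtain r s where x: "x = y * r + p * s" "r \<in> R" "s \<in> M" unfolding N_eq by blast
    have "p * s \<in> lin_span ?G"
      by (rule lin_span_map[OF M submod_lin_span 2(1,2) _ _ _ pG_span])
         (simp_all only: 2(3) x(3) distrib_left mult.left_commute mult_zero_right)
    moreover have "r * y \<in> lin_span ?G" by (rule submodD(3)[OF submod_lin_span x(2) y_span])
    ultimately show "x \<in> lin_span ?G"
      unfolding x(1) mult.commute[of y] by (intro submodD(2)[OF submod_lin_span])
  qed
  moreover have "?G \<subseteq> N"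
    using N_I[OF R_one submodD(1)[OF M]] N_I[OF R_zero] 2(2) by auto
  ultimately have "mu R N \<le> enat (card ?G)" using fin by (intro mu_le N)
  also have "card ?G \<le> 1 + card G"
    using card_insert_le_m1[of "Suc (card G)" "(*) p ` G" y] card_image_le[OF 2(1), of "(*) p"] by simp
  finally show ?thesis using 2(4) by (simp add: one_enat_def)
qed simp

end

section \<open>Ideal powers and the integral closure in terms of polynomials\<close>

locale polynomial_subring_ideal = polynomial_subring R for R :: "'k::field poly set" +
  fixes I :: "'k poly set"
  assumes ideal_I: "ideal I (poly_subring R)"
begin

definition ideal_pow :: "nat \<Rightarrow> 'k poly set" where
  "ideal_pow n = I [^]\<^bsub>ideals_set (poly_subring R)\<^esub> n"

lemma ideal_pow_0: "ideal_pow 0 = R"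
  by (simp add: ideal_pow_def ideals_set_def nat_pow_def)

lemma ideal_pow_Suc: "ideal_pow (Suc n) = ideal_prod (poly_subring R) (ideal_pow n) I"
  by (simp add: ideal_pow_def ideals_set_def nat_pow_def)

lemma ideal_ideal_pow: "ideal (ideal_pow n) (poly_subring R)"
  by (induction n)
     (use R.oneideal in \<open>auto simp: ideal_pow_0 ideal_pow_Suc ideal_I intro: R.ideal_prod_is_ideal\<close>)

lemma ideal_pow_subset: "x \<in> ideal_pow n \<Longrightarrow> x \<in> R"
  using ideal.Icarr[OF ideal_ideal_pow] by simp

lemma ideal_pow_add: "x \<in> ideal_pow n \<Longrightarrow> y \<in> ideal_pow n \<Longrightarrow> x + y \<in> ideal_pow n"
  using additive_subgroup.a_closed[OF ideal.axioms(1)[OF ideal_ideal_pow]] by simp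

lemma ideal_pow_zero: "0 \<in> ideal_pow n"
  using additive_subgroup.zero_closed[OF ideal.axioms(1)[OF ideal_ideal_pow]] by simp

lemma ideal_pow_mult: "r \<in> R \<Longrightarrow> x \<in> ideal_pow n \<Longrightarrow> r * x \<in> ideal_pow n"
  using ideal.I_l_closed[OF ideal_ideal_pow] by simp

lemma ideal_pow_uminus: "x \<in> ideal_pow n \<Longrightarrow> - x \<in> ideal_pow n"
  using ideal_pow_mult[of "- 1" x n] by (simp add: R_uminus R_one)

lemma ideal_pow_SucI: "x \<in> ideal_pow n \<Longrightarrow> y \<in> I \<Longrightarrow> x * y \<in> ideal_pow (Suc n)"
  using ideal_prod.prod[of x "ideal_pow n" y I "poly_subring R"] by (simp add: ideal_pow_Suc)

lemma power_in_ideal_pow: "y \<in> I \<Longrightarrow> y ^ n \<in> ideal_pow n"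
  by (induction n) (simp_all add: ideal_pow_0 R_one power_Suc2 ideal_pow_SucI del: power_Suc)

lemma ideal_pow_dvd:
  assumes "\<And>y. y \<in> I \<Longrightarrow> p dvd y" and "z \<in> ideal_pow n"
  shows "p ^ n dvd z"
  using assms(2)
proof (induction n arbitrary: z)
  case (Suc n)
  from Suc.prems[unfolded ideal_pow_Suc] show ?case
  proof (induction rule: ideal_prod.induct)
    case (prod i j)
    then have "p ^ n * p dvd i * j" using Suc.IH assms(1) by (intro mult_dvd_mono)
    then show ?case by (simp add: mult.commute)
  qed auto
qed simp

lemma integral_closure_iff:
  "x \<in> integral_closure (poly_subring R) I \<longleftrightarrow> x \<in> R \<and>
     (\<exists>n a. n \<ge> 1 \<and> (\<forall>i\<in>{1..n}. a i \<in> ideal_pow i) \<and> x ^ n + (\<Sum>i\<in>{1..n}. a i * x ^ (n - i)) = 0)"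
proof -
  \<comment> \<open>The two sums are only known to agree when all summands lie in \<open>R\<close>,
    hence the membership assumptions.\<close>
  have eq: "finsum (poly_subring R) (\<lambda>i. a i * x ^ (n - i)) {1..n} = (\<Sum>i\<in>{1..n}. a i * x ^ (n - i))"
    if "x \<in> R" "\<forall>i\<in>{1..n}. a i \<in> ideal_pow i" for n a
    using that by (intro finsum_eq) (auto intro!: R_mult R_power dest: ideal_pow_subset)
  show ?thesis
    unfolding integral_closure_def ideal_pow_def[symmetric]
    by (simp add: nat_pow_eq del: One_nat_def) (metis (no_types, lifting) eq)
qed

end

section \<open>The extended ideal IS and the integral closure as \<phi>S \<inter> R\<close>

lemma ideal_poly_ringI:
  assumes "0 \<in> J" and "\<And>x y. x \<in> J \<Longrightarrow> y \<in> J \<Longrightarrow> x + y \<in> J"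
    and mult: "\<And>r x. x \<in> J \<Longrightarrow> r * x \<in> J"
  shows "ideal J (poly_ring :: 'k::field poly ring)"
proof (rule idealI)
  have minus: "- x \<in> J" if "x \<in> J" for x
    using mult[OF that, of "- 1"] by simp
  show "subgroup J (add_monoid (poly_ring :: 'k poly ring))"
  proof (rule group.subgroupI)
    show "Group.group (add_monoid (poly_ring :: 'k poly ring))"
      using class_ring.a_group by simp
    fix a assume "a \<in> J"
    moreover have "inv\<^bsub>add_monoid (poly_ring :: 'k poly ring)\<^esub> a = - a"
      using fun_cong[OF matrix_vs_simps(14), of a] by (simp add: a_inv_def)
    ultimately show "inv\<^bsub>add_monoid (poly_ring :: 'k poly ring)\<^esub> a \<in> J"
      using minus by simp
  qed (use assms in auto)
qed (use assms class_ring.ring_axioms in \<open>auto simp: mult.commute\<close>)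

text \<open>IS is the smallest ideal of S containing \<open>I\<close>. Properties of \<phi> are
  obtained below by choosing a suitable \<open>J\<close>, instead of writing \<phi> as a combination
  of elements of \<open>I\<close>.\<close>

lemma extended_ideal_generator_mem:
  assumes "Idl\<^bsub>poly_ring\<^esub> I = PIdl\<^bsub>poly_ring\<^esub> \<phi>" and "ideal J poly_ring" and "I \<subseteq> J"
  shows "\<phi> \<in> J"
proof -
  have "Idl\<^bsub>poly_ring\<^esub> I \<subseteq> J" using assms(2,3) unfolding genideal_def by blast
  then show ?thesis using assms(1) by (auto simp: PIdl_poly_ring)
qed

lemma extended_ideal_generator_dvd:
  assumes "Idl\<^bsub>poly_ring\<^esub> I = PIdl\<^bsub>poly_ring\<^esub> \<phi>" and "y \<in> I"
  shows "\<phi> dvd y"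
proof -
  have "y \<in> Idl\<^bsub>poly_ring\<^esub> I" using assms(2) unfolding genideal_def by blast
  then show ?thesis using assms(1) by (simp add: PIdl_poly_ring)
qed

lemma poly_t_dvd_iff: "poly_t dvd p \<longleftrightarrow> poly p 0 = 0"
  using monom_1_dvd_iff'[of 1 p] by (simp add: poly_0_coeff_0)

locale extended_ideal = polynomial_subring_ideal R I
  for R :: "'k::field poly set" and I +
  fixes \<phi> :: "'k poly" and c0 :: nat
  assumes const_mem: "[:a:] \<in> R"
    and conductor: "poly_t ^ c0 dvd x \<Longrightarrow> x \<in> R"
    and c0_pos: "c0 > 0"
    and extension: "Idl\<^bsub>poly_ring\<^esub> I = PIdl\<^bsub>poly_ring\<^esub> \<phi>"
    and generator_nonzero: "\<phi> \<noteq> 0"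
begin

lemma conductor_mult_power_in_ideal_pow: "poly_t ^ c0 * \<phi> ^ n * s \<in> ideal_pow n"
proof (induction n arbitrary: s)
  case (Suc n)
  \<comment> \<open>The multipliers that carry t^c0 \<phi>^n S into I^(n+1). Quantifying over every
    \<open>s\<close> in S makes this an ideal of S and not merely an
    \<open>R\<close>-module.\<close>
  let ?J = "{z. \<forall>s. poly_t ^ c0 * \<phi> ^ n * s * z \<in> ideal_pow (Suc n)}"
  have "ideal ?J poly_ring"
  proof (rule ideal_poly_ringI)
    fix r x assume x: "x \<in> ?J"
    have "poly_t ^ c0 * \<phi> ^ n * s * (r * x) = poly_t ^ c0 * \<phi> ^ n * (s * r) * x" for s
      by (simp add: mult_ac)
    with x show "r * x \<in> ?J" by (simp only: mem_Collect_eq) blast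
  qed (simp_all add: ideal_pow_zero ideal_pow_add distrib_left)
  moreover have "I \<subseteq> ?J" using Suc.IH ideal_pow_SucI by blast
  ultimately have "\<phi> \<in> ?J" by (rule extended_ideal_generator_mem[OF extension])
  then have "poly_t ^ c0 * \<phi> ^ n * s * \<phi> \<in> ideal_pow (Suc n)" by blast
  then show ?case by (simp only: power_Suc mult_ac)
qed (simp add: ideal_pow_0 conductor)

text \<open>Otherwise the ideal of multiples of \<open>\<phi> * poly_t\<close> would contain
  \<open>I\<close>, hence \<phi>, and t would divide 1.\<close>

lemma generator_unit_multiple_mem:
  obtains y u where "y \<in> I" "y = \<phi> * u" "poly u 0 \<noteq> 0"
proof -
  have "\<exists>y\<in>I. \<not> \<phi> * poly_t dvd y"
  proof (rule ccontr)
    assume "\<not> (\<exists>y\<in>I. \<not> \<phi> * poly_t dvd y)"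
    then have "I \<subseteq> {z. \<phi> * poly_t dvd z}" by blast
    moreover have "ideal {z. \<phi> * poly_t dvd z} poly_ring" by (rule ideal_poly_ringI) auto
    ultimately have "\<phi> * poly_t dvd \<phi> * 1"
      using extended_ideal_generator_mem[OF extension] by fastforce
    then have "poly_t dvd (1 :: 'k poly)" using generator_nonzero by (simp only: dvd_mult_cancel_left simp_thms)
    then show False unfolding poly_t_dvd_iff by simp
  qed
  then obtain y where y: "y \<in> I" "\<not> \<phi> * poly_t dvd y" by blast
  obtain u where u: "y = \<phi> * u"
    using extended_ideal_generator_dvd[OF extension y(1)] by (rule dvdE)
  with y(2) have "poly u 0 \<noteq> 0" by (auto simp flip: poly_t_dvd_iff intro: mult_dvd_mono)
  with y(1) u that show thesis by blast
qed

lemma of_nat_mem: "of_nat n \<in> R"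
  using const_mem[of "of_nat n"] by (simp add: of_nat_poly)

lemma generator_multiple_integral:
  assumes "x \<in> R" and "\<phi> dvd x"
  shows "x \<in> integral_closure (poly_subring R) I"
proof -
  obtain s where s: "x = \<phi> * s" using assms(2) by (rule dvdE)
  obtain y u where y: "y \<in> I" and u: "y = \<phi> * u" "poly u 0 \<noteq> 0"
    by (rule generator_unit_multiple_mem)
  \<comment> \<open>With this constant, \<open>s - [:\<alpha>:] * u\<close> vanishes at 0, so adding
    \<open>b\<close> to \<open>x\<close> gains a factor t beyond \<phi>.\<close>
  define \<alpha> where "\<alpha> = poly s 0 / poly u 0"
  define b where "b = [:- \<alpha>:] * y"
  have "poly_t dvd s - [:\<alpha>:] * u" using u(2) unfolding poly_t_dvd_iff by (simp add: \<alpha>_def)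
  then obtain w where w: "s - [:\<alpha>:] * u = poly_t * w" by (rule dvdE)
  have "x + b = \<phi> * (s - [:\<alpha>:] * u)"
    by (simp add: s b_def u(1) algebra_simps)
  then have xb: "x + b = \<phi> * (poly_t * w)" by (simp only: w)
  \<comment> \<open>Each of the \<open>c0\<close> factors \<open>x + b\<close> contributes one t,
    which supplies the \<open>poly_t ^ c0\<close> needed for membership in the ideal power.\<close>
  define z where "z = x ^ c0 * (x + b) ^ c0"
  have "z = poly_t ^ c0 * \<phi> ^ (2 * c0) * (s * w) ^ c0"
    unfolding z_def xb unfolding s by (simp only: power_mult_distrib mult_2 mult_2_right power_add mult_ac)
  then have z_mem: "z \<in> ideal_pow (2 * c0)"
    by (simp only: conductor_mult_power_in_ideal_pow)
  have b_mem: "b ^ i \<in> ideal_pow i" for i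
    unfolding b_def power_mult_distrib
    by (rule ideal_pow_mult[OF R_power[OF const_mem] power_in_ideal_pow[OF y]])
  have z_eq: "z = x ^ (2 * c0) + (\<Sum>i\<in>{1..c0}. of_nat (c0 choose i) * b ^ i * x ^ (2 * c0 - i))"
  proof -
    have "z = x ^ c0 * (\<Sum>i\<le>c0. of_nat (c0 choose i) * b ^ i * x ^ (c0 - i))"
      by (simp add: z_def add.commute[of x] binomial_ring)
    also have "\<dots> = (\<Sum>i\<le>c0. of_nat (c0 choose i) * b ^ i * x ^ (2 * c0 - i))"
      unfolding sum_distrib_left
    proof (rule sum.cong[OF refl])
      fix i assume "i \<in> {..c0}"
      then have "2 * c0 - i = c0 + (c0 - i)" by simp
      then show "x ^ c0 * (of_nat (c0 choose i) * b ^ i * x ^ (c0 - i)) =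
          of_nat (c0 choose i) * b ^ i * x ^ (2 * c0 - i)"
        by (simp add: power_add mult_ac)
    qed
    also have "{..c0} = insert 0 {1..c0}" by auto
    finally show ?thesis by simp
  qed
  \<comment> \<open>The binomial expansion of \<open>z\<close>, with \<open>- z\<close> as the
    constant term and zeros strictly between \<open>c0\<close> and \<open>2 * c0\<close>. The two
    ranges do not collide because \<open>c0 > 0\<close>.\<close>
  define a where "a i = (if i = 2 * c0 then - z
    else if i \<le> c0 then of_nat (c0 choose i) * b ^ i else 0)" for i
  have "a i \<in> ideal_pow i" for i
    by (auto simp: a_def z_mem b_mem ideal_pow_uminus ideal_pow_zero intro!: ideal_pow_mult of_nat_mem)
  moreover have "x ^ (2 * c0) + (\<Sum>i\<in>{1..2 * c0}. a i * x ^ (2 * c0 - i)) = 0"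
  proof -
    have "(\<Sum>i\<in>{1..2 * c0}. a i * x ^ (2 * c0 - i)) =
        (\<Sum>i\<in>insert (2 * c0) {1..c0}. a i * x ^ (2 * c0 - i))"
      using c0_pos by (intro sum.mono_neutral_right) (auto simp: a_def)
    also have "\<dots> = - z + (\<Sum>i\<in>{1..c0}. a i * x ^ (2 * c0 - i))"
      using c0_pos by (subst sum.insert) (auto simp: a_def)
    also have "(\<Sum>i\<in>{1..c0}. a i * x ^ (2 * c0 - i)) =
        (\<Sum>i\<in>{1..c0}. of_nat (c0 choose i) * b ^ i * x ^ (2 * c0 - i))"
      using c0_pos by (intro sum.cong) (auto simp: a_def)
    finally show ?thesis by (simp add: z_eq)
  qed
  ultimately show ?thesis
    using assms(1) c0_pos unfolding integral_closure_iff
    by (intro conjI exI[of _ "2 * c0"] exI[of _ a]) auto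
qed

lemma integral_closure_eq: "integral_closure (poly_subring R) I = {x \<in> R. \<phi> dvd x}"
proof (intro equalityI subsetI)
  fix x assume "x \<in> integral_closure (poly_subring R) I"
  then obtain n a where x: "x \<in> R" "n \<ge> 1" "\<forall>i\<in>{1..n}. a i \<in> ideal_pow i"
    "x ^ n + (\<Sum>i\<in>{1..n}. a i * x ^ (n - i)) = 0"
    unfolding integral_closure_iff by blast
  have "\<phi> dvd x"
    using x(3) extended_ideal_generator_dvd[OF extension]
    by (intro dvd_of_integral_equation[OF generator_nonzero x(2) _ x(4)]) (blast intro: ideal_pow_dvd)
  with x(1) show "x \<in> {x \<in> R. \<phi> dvd x}" by simp
qed (use generator_multiple_integral in blast)

end

section \<open>The polynomial g and the decomposition of \<phi>S \<inter> R\<close>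

lemma coeff_assoc_poly: "coeff (assoc_poly f l) i = (if i < l then assoc_vec f l $ i else 0)"
  by (simp add: assoc_poly_def coeff_sum if_distrib cong: if_cong)

text \<open>The kernel equations say that the coefficients of fg in degrees 1 to l - 1 vanish, and
  the constant coefficient is the product of f(0) = 1 and the normalised entry 1.\<close>

lemma assoc_poly_mult_cong_one:
  assumes "poly f 0 = 1" and "l \<ge> 2"
  shows "poly_t ^ l dvd f * assoc_poly f l - 1"
proof -
  have v: "assoc_vec f l \<in> mat_kernel (coeff_mat f l) \<and> assoc_vec f l $ 0 = 1"
    unfolding assoc_vec_def by (rule theI'[OF assoc_vec_ex1[OF assms]])
  have f0: "coeff f 0 = 1" using assms(1) by (simp add: poly_0_coeff_0)
  have "coeff (f * assoc_poly f l - 1) i = 0" if i: "i < l" for i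
  proof -
    have "coeff (f * assoc_poly f l) i = coeff (assoc_poly f l * f) i" by (simp only: mult.commute)
    also have "\<dots> = (\<Sum>j\<le>i. coeff f (i - j) * assoc_vec f l $ j)"
      using i unfolding coeff_mult by (intro sum.cong) (simp_all add: coeff_assoc_poly)
    also have "\<dots> = (if i = 0 then 1 else 0)"
      using i v f0 by (simp add: mat_kernel_coeff_mat_iff[OF assms(2)])
    finally show ?thesis by simp
  qed
  then have "monom 1 l dvd f * assoc_poly f l - 1" unfolding monom_1_dvd_iff' by blast
  then show ?thesis by (simp add: monom_power)
qed

text \<open>\<open>u\<close> is the truncated geometric series in \<open>1 - g\<close>, which is
  divisible by t.\<close>

lemma inverse_mod_power_t:
  assumes "poly g 0 = 1"
  obtains u p where "u * g = 1 + poly_t ^ n * p"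
proof -
  have "poly_t dvd 1 - g" unfolding poly_t_dvd_iff using assms by simp
  then have "poly_t ^ n dvd (1 - g) ^ n" by (rule dvd_power_same)
  then obtain p where p: "(1 - g) ^ n = poly_t ^ n * p" by (rule dvdE)
  have "(\<Sum>i<n. (1 - g) ^ i) * g = 1 - (1 - g) ^ n"
    using one_diff_power_eq[of "1 - g" n] by (simp add: mult.commute)
  also have "\<dots> = 1 + poly_t ^ n * (- p)"
    unfolding p by simp
  finally show thesis by (rule that)
qed

lemma (in polynomial_subring) dvd_Int_decomposition:
  assumes conductor: "\<And>x. poly_t ^ c0 dvd x \<Longrightarrow> x \<in> R"
    and fg: "poly_t ^ l dvd f * g - 1" and "poly g 0 = 1"
    and "l \<ge> c0" and "c \<ge> c0" and "c \<ge> q"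
  shows "{x \<in> R. poly_t ^ q * f dvd x} =
    {poly_t ^ c * f * r + f * g * s | r s. r \<in> R \<and> s \<in> PIdl\<^bsub>poly_ring\<^esub> (poly_t ^ q) \<inter> R}"
proof -
  have t_c: "poly_t ^ c * z \<in> R" for z
    using assms(5) by (intro conductor dvd_mult2 le_imp_power_dvd)
  have t_l: "(f * g - 1) * z \<in> R" for z
    using assms(4) by (intro conductor dvd_mult2 dvd_trans[OF le_imp_power_dvd fg])
  show ?thesis
  proof (intro equalityI subsetI)
    fix x assume "x \<in> {x \<in> R. poly_t ^ q * f dvd x}"
    then obtain w where x: "x \<in> R" "x = poly_t ^ q * f * w" by (auto elim: dvdE)
    \<comment> \<open>Precision \<open>2 * c\<close> leaves two factors \<open>poly_t ^ c\<close> in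
      the error term: one belongs to the generator \<open>poly_t ^ c * f\<close>, the other puts the
      coefficient \<open>r\<close> into \<open>R\<close>.\<close>
    obtain u p where up: "u * g = 1 + poly_t ^ (2 * c) * p"
      by (rule inverse_mod_power_t[OF assms(3)])
    define s where "s = poly_t ^ q * w * u"
    define r where "r = - (poly_t ^ c * (poly_t ^ q * w * p))"
    have "f * g * s = x * (u * g)" by (simp only: s_def x(2) mult_ac)
    also have "\<dots> = x + poly_t ^ c * (poly_t ^ c * p * x)"
      unfolding up by (simp only: mult_2 mult_2_right power_add distrib_left mult_1_left mult_1_right mult_ac)
    finally have fgs: "f * g * s = x + poly_t ^ c * (poly_t ^ c * p * x)" .
    then have "f * g * s \<in> R" using R_add[OF x(1) t_c] by (simp only:)
    \<comment> \<open>This difference is \<open>s\<close>. The subtracted term lies in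
      \<open>R\<close> because \<open>f * g - 1\<close> is divisible by \<open>poly_t ^ l\<close>
      and \<open>l \<ge> c0\<close>.\<close>
    then have "f * g * s - (f * g - 1) * s \<in> R" using t_l by (rule R_diff)
    then have "s \<in> R" by (simp add: algebra_simps)
    moreover have "r \<in> R" unfolding r_def using t_c by (rule R_uminus)
    moreover have "poly_t ^ q dvd s" by (simp only: s_def mult.assoc dvd_triv_left)
    moreover have "x = poly_t ^ c * f * r + f * g * s"
      unfolding fgs by (simp only: r_def x(2)) (simp add: mult_ac)
    ultimately show "x \<in> {poly_t ^ c * f * r + f * g * s | r s.
        r \<in> R \<and> s \<in> PIdl\<^bsub>poly_ring\<^esub> (poly_t ^ q) \<inter> R}"
      unfolding PIdl_poly_ring by blast
  next
    fix x assume "x \<in> {poly_t ^ c * f * r + f * g * s | r s.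
        r \<in> R \<and> s \<in> PIdl\<^bsub>poly_ring\<^esub> (poly_t ^ q) \<inter> R}"
    then obtain r s where x: "x = poly_t ^ c * f * r + f * g * s"
      and "r \<in> R" "s \<in> R" "poly_t ^ q dvd s"
      unfolding PIdl_poly_ring by blast
    have "f * g = (f * g - 1) * 1 + 1" by simp
    then have "f * g \<in> R" using R_add[OF t_l R_one] by metis
    then have "x \<in> R"
      unfolding x mult.assoc[of "poly_t ^ c"] using t_c \<open>s \<in> R\<close> by (intro R_add R_mult[of "f * g"])
    moreover have "poly_t ^ q * f dvd x"
    proof -
      \<comment> \<open>This is where \<open>c \<ge> q\<close> enters.\<close>
      have "poly_t ^ q * f dvd poly_t ^ c * f * r"
        using assms(6) by (intro dvd_mult2 mult_dvd_mono le_imp_power_dvd dvd_refl)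
      moreover have "poly_t ^ q * f dvd s * f"
        using \<open>poly_t ^ q dvd s\<close> by (intro mult_dvd_mono dvd_refl)
      then have "poly_t ^ q * f dvd s * f * g" by (rule dvd_mult2)
      then have "poly_t ^ q * f dvd f * g * s" by (simp only: mult_ac)
      ultimately show ?thesis unfolding x by (rule dvd_add)
    qed
    ultimately show "x \<in> {x \<in> R. poly_t ^ q * f dvd x}" by simp
  qed
qed

theorem proposition3p2:
  fixes R I :: "'k::field poly set"
    and f g \<phi> :: "'k poly"
    and c0 c l q :: nat
  assumes "subring R poly_ring"
    and "\<forall>a. [:a:] \<in> R"
    and "c0 > 0"
    and "PIdl\<^bsub>poly_ring\<^esub> (poly_t ^ c0) \<subseteq> R"
    and "ideal I (poly_subring R)"
    and "I \<noteq> {0}"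
    and "Idl\<^bsub>poly_ring\<^esub> I = PIdl\<^bsub>poly_ring\<^esub> \<phi>"
    and "\<phi> = poly_t ^ q * f"
    and "poly f 0 = 1"
    and "l \<ge> c0"
    and "c \<ge> c0"
    and "l \<ge> 2"
    and "g = assoc_poly f l"
  shows "(c \<ge> q \<longrightarrow>
      integral_closure (poly_subring R) I =
        {poly_t ^ c * f * r + f * g * s | r s. r \<in> R \<and> s \<in> PIdl\<^bsub>poly_ring\<^esub> (poly_t ^ q) \<inter> R} \<and>
      mu R (integral_closure (poly_subring R) I) \<le> 1 + mu R (PIdl\<^bsub>poly_ring\<^esub> (poly_t ^ q) \<inter> R)) \<and>
    (q \<ge> c0 \<longrightarrow>
      integral_closure (poly_subring R) I = PIdl\<^bsub>poly_ring\<^esub> \<phi> \<and>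
      mu R (integral_closure (poly_subring R) I) = mu R UNIV)"
proof -
  have conductor: "x \<in> R" if "poly_t ^ c0 dvd x" for x
    using assms(4) that unfolding PIdl_poly_ring by blast
  have "f \<noteq> 0" using assms(9) by auto
  then have "\<phi> \<noteq> 0" unfolding assms(8) by simp
  interpret extended_ideal R I \<phi> c0
    by (intro extended_ideal.intro polynomial_subring_ideal.intro polynomial_subring.intro
          polynomial_subring_ideal_axioms.intro extended_ideal_axioms.intro assms
          spec[OF assms(2)] conductor \<open>\<phi> \<noteq> 0\<close>)
  have fg: "poly_t ^ l dvd f * g - 1"
    unfolding assms(13) by (rule assoc_poly_mult_cong_one[OF assms(9,12)])
  \<comment> \<open>Evaluating at 0 then gives \<open>poly g 0 = 1\<close>, as f(0) = 1.\<close>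
  have "poly_t dvd f * g - 1"
    using dvd_trans[OF dvd_power[of l poly_t] fg] assms(12) by simp
  then have "poly g 0 = 1" unfolding poly_t_dvd_iff using assms(9) by simp
  let ?N = "{x \<in> R. \<phi> dvd x}"
  have PIdl_Int: "PIdl\<^bsub>poly_ring\<^esub> p \<inter> R = {x \<in> R. p dvd x}" for p
    unfolding PIdl_poly_ring by blast
  show ?thesis
    unfolding integral_closure_eq
  proof (intro conjI impI)
    assume "c \<ge> q"
    show N_eq: "?N = {poly_t ^ c * f * r + f * g * s | r s.
        r \<in> R \<and> s \<in> PIdl\<^bsub>poly_ring\<^esub> (poly_t ^ q) \<inter> R}"
      unfolding assms(8)
      by (rule dvd_Int_decomposition[OF conductor fg \<open>poly g 0 = 1\<close> assms(10,11) \<open>c \<ge> q\<close>])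
    show "mu R ?N \<le> 1 + mu R (PIdl\<^bsub>poly_ring\<^esub> (poly_t ^ q) \<inter> R)"
      by (rule mu_cyclic_add_image_le[OF _ submod_dvd_Int N_eq])
         (unfold PIdl_Int, rule submod_dvd_Int)
  next
    assume "q \<ge> c0"
    \<comment> \<open>Multiples of \<phi> are divisible by \<open>poly_t ^ q\<close>, hence by
      \<open>poly_t ^ c0\<close>, so intersecting with \<open>R\<close> removes nothing.\<close>
    have "x \<in> R" if "\<phi> dvd x" for x
      using \<open>q \<ge> c0\<close> that unfolding assms(8)
      by (intro conductor) (blast intro: dvd_trans le_imp_power_dvd dvd_mult_left)
    then show N_eq: "?N = PIdl\<^bsub>poly_ring\<^esub> \<phi>" unfolding PIdl_poly_ring by blast
    also have "\<dots> = range ((*) \<phi>)" unfolding PIdl_poly_ring by (auto elim: dvdE)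
    finally show "mu R ?N = mu R UNIV"
      using mu_mult_image[OF \<open>\<phi> \<noteq> 0\<close> submod_UNIV] by simp
  qed
qed

end
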